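(* Let $k$ be a field of characteristic $0$, let $b\in k\setminus k^{3}$, and let $K=k(\alpha)$ where $\alpha^3+b=0$. Let $m$ be a positive integer and $f(t)=t^{3m}+a_2t^m+a_1t+a_0\in k[t]$ with $a_1\neq 0$. Then the variety $\mathcal{S}_f\subset\mathbb{A}^4$ defined by \[ X_{1}^3-bX_{2}^3+b^2X_{3}^3+3bX_{1}X_{2}X_{3}=f(t) \] is $k$-unirational.
   Context: The left-hand side is the norm form $N_{K/k}(X_1+\alpha X_2+\alpha^2X_3)$. A variety over $k$ is $k$-unirational if there is a dominant rational map defined over $k$ from some affine space $\mathbb{A}^n_k$ to it. *)

theory Defs
  imports
    "HOL-Library.Poly_Mapping"
    "HOL-Library.FuncSet"
    "HOL-Computational_Algebra.Polynomial"
    "HOL-Algebra.Algebraic_Closure_Type"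
begin

section \<open>Polynomials in several variables\<close>

text \<open>A polynomial in the variables $x_0, x_1, \ldots$ is a finitely supported map from
  exponent vectors to coefficients. The ring of polynomials in $n$ variables consists of those
  that only involve $x_0, \ldots, x_{n-1}$.\<close>

type_synonym 'a mpoly = "(nat \<Rightarrow>\<^sub>0 nat) \<Rightarrow>\<^sub>0 'a"

definition mpoly_ring :: "nat \<Rightarrow> 'a::zero mpoly set" where
  "mpoly_ring n = {p. \<forall>m \<in> Poly_Mapping.keys p. Poly_Mapping.keys m \<subseteq> {..<n}}"

definition Const :: "'a::zero \<Rightarrow> 'a mpoly" where
  "Const c = Poly_Mapping.single 0 c"

definition Var :: "nat \<Rightarrow> 'a::zero_neq_one mpoly" where
  "Var i = Poly_Mapping.single (Poly_Mapping.single i 1) 1"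

text \<open>Value at \<open>x\<close> of a polynomial whose coefficients are first mapped through \<open>h\<close>; below
  \<open>h\<close> is \<open>to_ac\<close> for polynomials over $k$ and the identity for polynomials over
  $\overline{k}$.\<close>

definition eval_mpoly :: "('a::zero \<Rightarrow> 'b::comm_semiring_1) \<Rightarrow> (nat \<Rightarrow> 'b) \<Rightarrow> 'a mpoly \<Rightarrow> 'b" where
  "eval_mpoly h x p = (\<Sum>m \<in> Poly_Mapping.keys p.
     h (Poly_Mapping.lookup p m) * (\<Prod>i \<in> Poly_Mapping.keys m. x i ^ Poly_Mapping.lookup m i))"


section \<open>Affine varieties and their Zariski topology\<close>

text \<open>Varieties over $k$ are given by equations over $k$ and identified with their sets of
  geometric points, i.e. points with coordinates in \<open>'k alg_closure\<close>. Points of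
  $\mathbb{A}^n$ are extensional functions on \<open>{..<n}\<close>.\<close>

definition affine_space :: "nat \<Rightarrow> (nat \<Rightarrow> 'a) set" where
  "affine_space n = {..<n} \<rightarrow>\<^sub>E UNIV"

definition zero_locus ::
    "('a::zero \<Rightarrow> 'b::comm_semiring_1) \<Rightarrow> nat \<Rightarrow> 'a mpoly set \<Rightarrow> (nat \<Rightarrow> 'b) set" where
  "zero_locus h n P = {x \<in> affine_space n. \<forall>p \<in> P. eval_mpoly h x p = 0}"

definition zariski_closed :: "nat \<Rightarrow> (nat \<Rightarrow> 'a::comm_semiring_1) set \<Rightarrow> bool" where
  "zariski_closed n Z \<longleftrightarrow> (\<exists>P \<subseteq> mpoly_ring n. Z = zero_locus (\<lambda>c. c) n P)"

definition zariski_dense :: "nat \<Rightarrow> (nat \<Rightarrow> 'a::comm_semiring_1) set \<Rightarrow> (nat \<Rightarrow> 'a) set \<Rightarrow> bool" where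
  "zariski_dense n U V \<longleftrightarrow> U \<subseteq> V \<and> (\<forall>Z. zariski_closed n Z \<longrightarrow> U \<subseteq> Z \<longrightarrow> V \<subseteq> Z)"


section \<open>Rational maps and unirationality\<close>

text \<open>A rational map over $k$ from $\mathbb{A}^n$ to a subvariety of $\mathbb{A}^N$ is represented
  by $N$ fractions of polynomials over $k$ in $n$ variables, as pairs (numerator, denominator). It
  is evaluated where no denominator vanishes, a nonempty Zariski open set that may be smaller than
  the maximal domain of definition; neither the requirement that the map lands in the variety nor
  dominance depends on the choice of this open set.\<close>

type_synonym 'a rat_tuple = "nat \<Rightarrow> 'a mpoly \<times> 'a mpoly"

definition rat_dom :: "nat \<Rightarrow> nat \<Rightarrow> 'k::field rat_tuple \<Rightarrow> (nat \<Rightarrow> 'k alg_closure) set" where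
  "rat_dom n N \<phi> = {u \<in> affine_space n. \<forall>i<N. eval_mpoly to_ac u (snd (\<phi> i)) \<noteq> 0}"

definition rat_apply ::
    "nat \<Rightarrow> 'k::field rat_tuple \<Rightarrow> (nat \<Rightarrow> 'k alg_closure) \<Rightarrow> (nat \<Rightarrow> 'k alg_closure)" where
  "rat_apply N \<phi> u =
     (\<lambda>i \<in> {..<N}. eval_mpoly to_ac u (fst (\<phi> i)) / eval_mpoly to_ac u (snd (\<phi> i)))"

definition rational_map ::
    "nat \<Rightarrow> nat \<Rightarrow> (nat \<Rightarrow> 'k::field alg_closure) set \<Rightarrow> 'k rat_tuple \<Rightarrow> bool" where
  "rational_map n N V \<phi> \<longleftrightarrow>
     (\<forall>i<N. fst (\<phi> i) \<in> mpoly_ring n \<and> snd (\<phi> i) \<in> mpoly_ring n \<and> snd (\<phi> i) \<noteq> 0) \<and>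
     rat_apply N \<phi> ` rat_dom n N \<phi> \<subseteq> V"

definition dominant ::
    "nat \<Rightarrow> nat \<Rightarrow> (nat \<Rightarrow> 'k::field alg_closure) set \<Rightarrow> 'k rat_tuple \<Rightarrow> bool" where
  "dominant n N V \<phi> \<longleftrightarrow> zariski_dense N (rat_apply N \<phi> ` rat_dom n N \<phi>) V"

text \<open>$k$-unirationality of the affine variety in $\mathbb{A}^N$ cut out by a set of polynomials
  over the field $k$, which is the type \<open>'k\<close>.\<close>

definition k_unirational :: "nat \<Rightarrow> 'k::field mpoly set \<Rightarrow> bool" where
  "k_unirational N P \<longleftrightarrow>
     (\<exists>n \<phi>. rational_map n N (zero_locus to_ac N P) \<phi> \<and> dominant n N (zero_locus to_ac N P) \<phi>)"


section \<open>The variety \<open>\<S>\<^sub>f\<close>\<close>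

text \<open>The coordinates $X_1, X_2, X_3, t$ of $\mathbb{A}^4$ are the variables with index
  0, 1, 2, 3.\<close>

definition norm_form :: "'a::comm_ring_1 \<Rightarrow> 'a \<Rightarrow> 'a \<Rightarrow> 'a \<Rightarrow> 'a" where
  "norm_form b x1 x2 x3 = x1 ^ 3 - b * x2 ^ 3 + b ^ 2 * x3 ^ 3 + 3 * b * x1 * x2 * x3"

definition S_equation :: "'k::comm_ring_1 \<Rightarrow> 'k poly \<Rightarrow> 'k mpoly" where
  "S_equation b f = norm_form (Const b) (Var 0) (Var 1) (Var 2) - poly (map_poly Const f) (Var 3)"

text \<open>The form is the norm of $x_1 + \alpha x_2 + \alpha^2 x_3$: the conjugates of $\alpha$
  are $\alpha$, $\omega\alpha$ and $\omega^2\alpha$ for a primitive cube root of unity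
  $\omega$.\<close>

lemma norm_form_eq_prod_conjugates:
  fixes \<alpha> \<omega> b x1 x2 x3 :: "'a::comm_ring_1"
  assumes "\<alpha> ^ 3 + b = 0" and "\<omega> ^ 2 + \<omega> + 1 = 0"
  shows "norm_form b x1 x2 x3 =
    (x1 + \<alpha> * x2 + \<alpha> ^ 2 * x3) *
    (x1 + (\<omega> * \<alpha>) * x2 + (\<omega> * \<alpha>) ^ 2 * x3) *
    (x1 + (\<omega> ^ 2 * \<alpha>) * x2 + (\<omega> ^ 2 * \<alpha>) ^ 2 * x3)"
proof -
  have b: "b = - (\<alpha> ^ 3)"
    using assms(1) by (simp add: eq_neg_iff_add_eq_0 add.commute)
  have w: "\<omega> * \<omega> = - \<omega> - 1" "\<omega> * (\<omega> * z) = - (\<omega> * z) - z" for z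
  proof -
    show *: "\<omega> * \<omega> = - \<omega> - 1"
      using assms(2) by (simp add: power2_eq_square eq_neg_iff_add_eq_0 eq_diff_eq add.assoc add.commute[of \<omega>])
    show "\<omega> * (\<omega> * z) = - (\<omega> * z) - z"
      unfolding mult.assoc[symmetric] * by (simp add: algebra_simps)
  qed
  show ?thesis
    by (simp add: norm_form_def b power2_eq_square power3_eq_cube algebra_simps w)
qed


subsection \<open>The geometric points of \<open>\<S>\<^sub>f\<close>\<close>

lemma eval_mpoly_superset:
  assumes "finite A" "Poly_Mapping.keys p \<subseteq> A" "h 0 = 0"
  shows "eval_mpoly h x p = (\<Sum>m \<in> A.
     h (Poly_Mapping.lookup p m) * (\<Prod>i \<in> Poly_Mapping.keys m. x i ^ Poly_Mapping.lookup m i))"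
  unfolding eval_mpoly_def using assms
  by (intro sum.mono_neutral_left) (auto simp: in_keys_iff)

lemma monom_superset:
  fixes x :: "nat \<Rightarrow> 'b::comm_semiring_1"
  assumes "finite A" "Poly_Mapping.keys m \<subseteq> A"
  shows "(\<Prod>i \<in> Poly_Mapping.keys m. x i ^ Poly_Mapping.lookup m i) =
         (\<Prod>i \<in> A. x i ^ Poly_Mapping.lookup m i)"
  using assms by (intro prod.mono_neutral_left) (auto simp: in_keys_iff)

lemma monom_add:
  fixes x :: "nat \<Rightarrow> 'b::comm_semiring_1"
  shows "(\<Prod>i \<in> Poly_Mapping.keys (m + m'). x i ^ Poly_Mapping.lookup (m + m') i) =
     (\<Prod>i \<in> Poly_Mapping.keys m. x i ^ Poly_Mapping.lookup m i) *
     (\<Prod>i \<in> Poly_Mapping.keys m'. x i ^ Poly_Mapping.lookup m' i)"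
proof -
  let ?A = "Poly_Mapping.keys m \<union> Poly_Mapping.keys m'"
  have "Poly_Mapping.keys (m + m') \<subseteq> ?A" by (rule keys_add)
  then have "(\<Prod>i \<in> Poly_Mapping.keys (m + m'). x i ^ Poly_Mapping.lookup (m + m') i) =
      (\<Prod>i \<in> ?A. x i ^ Poly_Mapping.lookup (m + m') i)"
    by (intro monom_superset) auto
  then show ?thesis
    by (simp add: monom_superset[of ?A m] monom_superset[of ?A m']
        lookup_add power_add prod.distrib)
qed

locale coeff_hom =
  fixes h :: "'a::comm_ring_1 \<Rightarrow> 'b::comm_ring_1"
  assumes h_add: "h (x + y) = h x + h y"
    and h_mult: "h (x * y) = h x * h y"
    and h_1: "h 1 = 1"
begin

lemma h_0: "h 0 = 0"
  using h_add[of 0 0] by simp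

lemma eval_0: "eval_mpoly h x 0 = 0"
  by (simp add: eval_mpoly_def)

lemma eval_single: "eval_mpoly h x (Poly_Mapping.single m c) =
    h c * (\<Prod>i \<in> Poly_Mapping.keys m. x i ^ Poly_Mapping.lookup m i)"
  by (simp add: eval_mpoly_superset[of "{m}"] h_0)

lemma eval_Const: "eval_mpoly h x (Const c) = h c"
  by (simp add: Const_def eval_single)

lemma eval_Var: "eval_mpoly h x (Var i) = x i"
  by (simp add: Var_def eval_single h_1)

lemma eval_add: "eval_mpoly h x (p + q) = eval_mpoly h x p + eval_mpoly h x q"
  using keys_add[of p q]
  by (simp add: eval_mpoly_superset[of "Poly_Mapping.keys p \<union> Poly_Mapping.keys q"]
      h_0 h_add lookup_add distrib_right sum.distrib)

lemma eval_single_mult: "eval_mpoly h x (Poly_Mapping.single m c * q) =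
    eval_mpoly h x (Poly_Mapping.single m c) * eval_mpoly h x q"
proof (induction q rule: update_induct)
  case const
  then show ?case by (simp add: eval_0)
next
  case (update q m' c')
  have "Poly_Mapping.update m' c' q = q + Poly_Mapping.single m' c'"
    using update.hyps
    by (intro poly_mapping_eqI) (auto simp: lookup_update lookup_add lookup_single in_keys_iff when_def)
  then show ?case using update.IH
    by (simp add: eval_add distrib_left mult_single eval_single h_mult monom_add mult_ac)
qed

lemma eval_mult: "eval_mpoly h x (p * q) = eval_mpoly h x p * eval_mpoly h x q"
proof (induction p rule: update_induct)
  case const
  then show ?case by (simp add: eval_0)
next
  case (update p m c)
  have "Poly_Mapping.update m c p = p + Poly_Mapping.single m c"
    using update.hyps
    by (intro poly_mapping_eqI) (auto simp: lookup_update lookup_add lookup_single in_keys_iff when_def)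
  then show ?case using update.IH
    by (simp add: eval_add distrib_right eval_single_mult)
qed

lemma eval_1: "eval_mpoly h x 1 = 1"
  using eval_Const[of x 1] by (simp add: Const_def h_1)

lemma eval_uminus: "eval_mpoly h x (- p) = - eval_mpoly h x p"
  using eval_add[of x p "- p"] by (simp add: eval_0 eq_neg_iff_add_eq_0 add.commute)

lemma eval_diff: "eval_mpoly h x (p - q) = eval_mpoly h x p - eval_mpoly h x q"
  using eval_add[of x p "- q"] by (simp add: eval_uminus)

lemma eval_power: "eval_mpoly h x (p ^ n) = eval_mpoly h x p ^ n"
  by (induction n) (simp_all add: eval_1 eval_mult)

lemma eval_numeral: "eval_mpoly h x (numeral w) = numeral w"
  by (induction w) (simp_all only: numeral.simps eval_1 eval_add)

lemma eval_poly_Const: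
  "eval_mpoly h x (poly (map_poly Const f) q) = poly (map_poly h f) (eval_mpoly h x q)"
proof (induction f)
  case 0
  then show ?case by (simp add: eval_0)
next
  case (pCons a f)
  have "Const (0 :: 'a) = 0" by (simp add: Const_def)
  then show ?case using pCons
    by (simp add: map_poly_pCons h_0 eval_add eval_mult eval_Const)
qed

lemma eval_S_equation:
  "eval_mpoly h x (S_equation b f) =
     norm_form (h b) (x 0) (x 1) (x 2) - poly (map_poly h f) (x 3)"
  unfolding S_equation_def norm_form_def
  by (simp add: eval_diff eval_add eval_mult eval_power eval_numeral eval_Const eval_Var
      eval_poly_Const)

end

interpretation to_ac: coeff_hom "to_ac :: 'k::field \<Rightarrow> 'k alg_closure"
  by unfold_locales simp_all

lemma mem_S_iff:
  fixes b :: "'k::field"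
  shows "x \<in> zero_locus to_ac 4 {S_equation b f} \<longleftrightarrow>
    x \<in> affine_space 4 \<and>
    x 0 ^ 3 - to_ac b * x 1 ^ 3 + to_ac b ^ 2 * x 2 ^ 3 + 3 * to_ac b * x 0 * x 1 * x 2
      = poly (map_poly to_ac f) (x 3)"
  by (simp add: zero_locus_def to_ac.eval_S_equation norm_form_def)

end

theory Submission
  imports Defs
begin

text \<open>Setting \<open>X\<^sub>1 = t ^ m\<close> cancels the leading term of $f$, and \<open>3 b X\<^sub>2 X\<^sub>3 = a\<^sub>2\<close> cancels the next one;
  the remaining equation is linear in $t$ and is solved for $t$ because \<open>a\<^sub>1 \<noteq> 0\<close>. This gives a
  rational curve on the threefold with parameter \<open>u = X\<^sub>2\<close> on which $t$ is not constant. Multiplying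
  its points by the elements \<open>v\<^sup>3 / N(v)\<close> of norm one sweeps out, over the algebraic closure, every
  point with \<open>f(t) (a\<^sub>1 t + a\<^sub>0) \<noteq> 0\<close>. These points are dense because, in the coordinates given by the
  three conjugates, each point of the threefold lies on a polynomial curve in it along which $t$ is
  not constant.\<close>

section \<open>Polynomial rings and evaluation\<close>

lemma mpoly_ring_Const: "Const c \<in> mpoly_ring n"
  by (simp add: mpoly_ring_def Const_def)

lemma mpoly_ring_Var: "i < n \<Longrightarrow> (Var i :: 'a::zero_neq_one mpoly) \<in> mpoly_ring n"
  by (simp add: mpoly_ring_def Var_def)

lemma mpoly_ring_add:
  "p \<in> mpoly_ring n \<Longrightarrow> q \<in> mpoly_ring n \<Longrightarrow> (p + q :: 'a::comm_ring_1 mpoly) \<in> mpoly_ring n"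
  using keys_add[of p q] by (auto simp: mpoly_ring_def)

lemma mpoly_ring_uminus:
  "p \<in> mpoly_ring n \<Longrightarrow> (- p :: 'a::comm_ring_1 mpoly) \<in> mpoly_ring n"
  by (auto simp: mpoly_ring_def in_keys_iff)

lemma mpoly_ring_diff:
  "p \<in> mpoly_ring n \<Longrightarrow> q \<in> mpoly_ring n \<Longrightarrow> (p - q :: 'a::comm_ring_1 mpoly) \<in> mpoly_ring n"
  using mpoly_ring_add[of p n "- q"] mpoly_ring_uminus[of q n] by simp

lemma mpoly_ring_mult:
  assumes "p \<in> mpoly_ring n" "q \<in> mpoly_ring n"
  shows "(p * q :: 'a::comm_ring_1 mpoly) \<in> mpoly_ring n"
  unfolding mpoly_ring_def
proof (intro CollectI ballI)
  fix m assume "m \<in> Poly_Mapping.keys (p * q)"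
  then obtain a c where "m = a + c" "a \<in> Poly_Mapping.keys p" "c \<in> Poly_Mapping.keys q"
    using keys_mult[of p q] by blast
  then show "Poly_Mapping.keys m \<subseteq> {..<n}"
    using assms keys_add[of a c] unfolding mpoly_ring_def by blast
qed

lemma mpoly_ring_1: "(1 :: 'a::comm_ring_1 mpoly) \<in> mpoly_ring n"
  using mpoly_ring_Const[of "1 :: 'a" n] by (simp add: Const_def)

lemma mpoly_ring_power:
  "p \<in> mpoly_ring n \<Longrightarrow> (p ^ k :: 'a::comm_ring_1 mpoly) \<in> mpoly_ring n"
  by (induction k) (simp_all add: mpoly_ring_1 mpoly_ring_mult)

lemma mpoly_ring_numeral: "(numeral w :: 'a::comm_ring_1 mpoly) \<in> mpoly_ring n"
  by (induction w) (simp_all only: numeral.simps mpoly_ring_1 mpoly_ring_add)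

lemmas mpoly_ring_intros = mpoly_ring_Const mpoly_ring_Var mpoly_ring_add mpoly_ring_diff
  mpoly_ring_mult mpoly_ring_power mpoly_ring_numeral

section \<open>Restriction of polynomials to parametrized curves\<close>

lemma poly_eval_mpoly:
  fixes c :: "nat \<Rightarrow> 'a::comm_ring_1 poly"
  shows "poly (eval_mpoly (\<lambda>a. [:a:]) c p) r = eval_mpoly (\<lambda>a. a) (\<lambda>i. poly (c i) r) p"
  by (simp add: eval_mpoly_def poly_sum poly_prod poly_power)

text \<open>Each equation of \<open>Z\<close> restricts to a univariate polynomial in the curve
  parameter. It vanishes off the finite set \<open>B\<close>, hence at infinitely many points in
  characteristic 0, so it is zero.\<close>

lemma zariski_closed_curve:
  fixes c :: "nat \<Rightarrow> 'a::{field_char_0} poly"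
  assumes "zariski_closed n Z" "finite B"
    and aff: "\<And>r. (\<lambda>i. poly (c i) r) \<in> affine_space n"
    and curve: "\<And>r. r \<notin> B \<Longrightarrow> (\<lambda>i. poly (c i) r) \<in> Z"
  shows "(\<lambda>i. poly (c i) r) \<in> Z"
proof -
  obtain P where Z: "Z = zero_locus (\<lambda>c. c) n P"
    using assms(1) by (auto simp: zariski_closed_def)
  have "eval_mpoly (\<lambda>a. a) (\<lambda>i. poly (c i) r) p = 0" if "p \<in> P" for p
  proof -
    let ?e = "eval_mpoly (\<lambda>a. [:a:]) c p"
    have "- B \<subseteq> {r. poly ?e r = 0}"
      using curve that by (auto simp: Z zero_locus_def poly_eval_mpoly)
    moreover have "infinite (- B)"
      using \<open>finite B\<close> by (metis finite_compl infinite_UNIV_char_0)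
    ultimately have "?e = 0"
      using finite_subset poly_roots_finite by blast
    then show ?thesis by (metis poly_eval_mpoly poly_0)
  qed
  then show ?thesis using aff by (simp add: Z zero_locus_def)
qed


section \<open>The cubic algebra and its splitting\<close>

text \<open>Multiplication in k[T]/(T^3 + b) in the basis 1, T, T^2. Elements are functions on all
  naturals, so a point of A^4 can serve directly as an element, its coordinate t being
  ignored.\<close>

definition kmul :: "'a::comm_ring_1 \<Rightarrow> (nat \<Rightarrow> 'a) \<Rightarrow> (nat \<Rightarrow> 'a) \<Rightarrow> nat \<Rightarrow> 'a" where
  "kmul b x y i =
     (if i = 0 then x 0 * y 0 - b * (x 1 * y 2 + x 2 * y 1)
      else if i = 1 then x 0 * y 1 + x 1 * y 0 - b * (x 2 * y 2)
      else x 0 * y 2 + x 1 * y 1 + x 2 * y 0)"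

text \<open>The evaluation T = \<beta>; it is multiplicative when \<beta> is a root of T^3 +
  b.\<close>

definition conj_value :: "'a::comm_ring_1 \<Rightarrow> (nat \<Rightarrow> 'a) \<Rightarrow> 'a" where
  "conj_value \<beta> x = x 0 + \<beta> * x 1 + \<beta> ^ 2 * x 2"

definition knorm :: "'a::comm_ring_1 \<Rightarrow> (nat \<Rightarrow> 'a) \<Rightarrow> 'a" where
  "knorm b x = norm_form b (x 0) (x 1) (x 2)"

lemma conj_value_kmul:
  assumes "\<beta> ^ 3 + b = 0"
  shows "conj_value \<beta> (kmul b x y) = conj_value \<beta> x * conj_value \<beta> y"
proof -
  have b: "b = - (\<beta> ^ 3)"
    using assms by (simp add: eq_neg_iff_add_eq_0 add.commute)
  show ?thesis
    by (simp add: conj_value_def kmul_def b algebra_simps power2_eq_square power3_eq_cube)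
qed

lemma conj_value_divide:
  fixes \<beta> :: "'a::field"
  shows "conj_value \<beta> (\<lambda>i. x i / d) = conj_value \<beta> x / d"
  by (simp add: conj_value_def add_divide_distrib)

lemma (in coeff_hom) eval_kmul:
  "eval_mpoly h u (kmul (Const b) x y i) =
     kmul (h b) (\<lambda>j. eval_mpoly h u (x j)) (\<lambda>j. eval_mpoly h u (y j)) i"
  by (simp add: kmul_def eval_add eval_diff eval_mult eval_Const)

lemma mpoly_ring_kmul:
  assumes "\<And>i. x i \<in> mpoly_ring n" "\<And>i. y i \<in> mpoly_ring n"
  shows "kmul (Const b) x y i \<in> mpoly_ring n"
  using assms by (auto simp: kmul_def intro!: mpoly_ring_intros)

text \<open>The three evaluations at \<alpha>, \<omega>\<alpha>, \<omega>^2\<alpha> split the cubic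
  algebra into three copies of the field. Multiplication becomes coordinatewise and the norm becomes
  the product of the coordinates.\<close>

locale cubic_splitting =
  fixes \<alpha> \<omega> b :: "'a::field_char_0"
  assumes root: "\<alpha> ^ 3 + b = 0" and \<omega>: "\<omega> ^ 2 + \<omega> + 1 = 0" and b: "b \<noteq> 0"
begin

lemma \<omega>_cube: "\<omega> ^ 3 = 1"
proof -
  have "\<omega> ^ 3 - 1 = (\<omega> - 1) * (\<omega> ^ 2 + \<omega> + 1)"
    by (simp add: algebra_simps power2_eq_square power3_eq_cube)
  then show ?thesis by (simp add: \<omega>)
qed

lemma \<omega>_sq: "\<omega> * \<omega> = - \<omega> - 1"
  using \<omega> by (simp add: power2_eq_square eq_neg_iff_add_eq_0 eq_diff_eq add.assoc add.commute[of \<omega>])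

lemma \<omega>_sq': "\<omega> * (\<omega> * z) = - (\<omega> * z) - z"
  unfolding mult.assoc[symmetric] \<omega>_sq by (simp add: algebra_simps)

lemma nonzero: "\<alpha> \<noteq> 0"
  using root b by auto

lemma root1: "(\<omega> * \<alpha>) ^ 3 + b = 0"
  using root by (simp add: power_mult_distrib \<omega>_cube)

lemma root2: "(\<omega> ^ 2 * \<alpha>) ^ 3 + b = 0"
proof -
  have "(\<omega> ^ 2) ^ 3 = (\<omega> ^ 3) ^ 2" by (simp flip: power_mult)
  then show ?thesis using root by (simp add: power_mult_distrib \<omega>_cube)
qed

abbreviation "Y0 \<equiv> conj_value \<alpha>"
abbreviation "Y1 \<equiv> conj_value (\<omega> * \<alpha>)"
abbreviation "Y2 \<equiv> conj_value (\<omega> ^ 2 * \<alpha>)"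

lemma norm_eq: "knorm b x = Y0 x * Y1 x * Y2 x"
  unfolding conj_value_def knorm_def by (rule norm_form_eq_prod_conjugates[OF root \<omega>])

text \<open>Inverse of (\<open>Y0\<close>, \<open>Y1\<close>, \<open>Y2\<close>): the inverse
  discrete Fourier transform for the cube roots of unity, rescaled by powers of \<alpha>.\<close>

definition from_conj :: "'a \<Rightarrow> 'a \<Rightarrow> 'a \<Rightarrow> nat \<Rightarrow> 'a" where
  "from_conj y0 y1 y2 i =
     (if i = 0 then (y0 + y1 + y2) / 3
      else if i = 1 then (y0 + \<omega> ^ 2 * y1 + \<omega> * y2) / (3 * \<alpha>)
      else (y0 + \<omega> * y1 + \<omega> ^ 2 * y2) / (3 * \<alpha> ^ 2))"

lemma conj_value_from_conj:
  "Y0 (from_conj y0 y1 y2) = y0"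
  "Y1 (from_conj y0 y1 y2) = y1"
  "Y2 (from_conj y0 y1 y2) = y2"
  using nonzero
  by (simp_all add: conj_value_def from_conj_def field_simps power2_eq_square \<omega>_sq \<omega>_sq')

lemma from_conj_conj_value:
  assumes "i < 3"
  shows "from_conj (Y0 x) (Y1 x) (Y2 x) i = x i"
proof -
  consider "i = 0" | "i = 1" | "i = 2" using assms by linarith
  then show ?thesis
    using nonzero
    by cases (simp_all add: conj_value_def from_conj_def field_simps power2_eq_square \<omega>_sq \<omega>_sq')
qed

lemma conj_value_eqI:
  assumes "Y0 x = Y0 y" "Y1 x = Y1 y" "Y2 x = Y2 y" "i < 3"
  shows "x i = y i"
  using assms from_conj_conj_value[of i x] from_conj_conj_value[of i y] by simp

lemmas conj_value_kmul' = conj_value_kmul[OF root] conj_value_kmul[OF root1] conj_value_kmul[OF root2]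

lemma norm_kmul:
  "knorm b (kmul b x y) =
     knorm b x * knorm b y"
  by (simp add: norm_eq conj_value_kmul')

text \<open>In conjugate coordinates the threefold is y0 y1 y2 = f(t), so a polynomial curve in it
  is a factorization of f(t(r)) into three factors. As t(r) is not constant, g(t(r)) vanishes for
  only finitely many r; \<open>Z\<close> contains the rest of the curve, hence also its point
  \<open>x\<close> at r = 0.\<close>

lemma norm_curve:
  assumes "zariski_closed 4 Z" and g: "g \<noteq> 0"
    and Z: "\<And>x. x \<in> affine_space 4 \<Longrightarrow> knorm b x = poly f (x 3) \<Longrightarrow>
              poly g (x 3) \<noteq> 0 \<Longrightarrow> x \<in> Z"
    and x: "x \<in> affine_space 4"
    and curve: "y0 * y1 * y2 = pcompose f t" and t: "degree t > 0"
    and at: "poly y0 0 = Y0 x" "poly y1 0 = Y1 x" "poly y2 0 = Y2 x" "poly t 0 = x 3"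
  shows "x \<in> Z"
proof -
  \<comment> \<open>This is \<open>from_conj\<close> applied to polynomials. The constant
    \<open>undefined\<close> at indices from 4 on makes the points extensional, as
    \<open>affine_space 4\<close> demands.\<close>
  define c where "c i =
     (if i = 0 then smult (1 / 3) (y0 + y1 + y2)
      else if i = 1 then smult (1 / (3 * \<alpha>)) (y0 + smult (\<omega> ^ 2) y1 + smult \<omega> y2)
      else if i = 2 then smult (1 / (3 * \<alpha> ^ 2)) (y0 + smult \<omega> y1 + smult (\<omega> ^ 2) y2)
      else if i = 3 then t else [:undefined:])" for i :: nat
  have ev: "poly (c i) r = (if i < 3 then from_conj (poly y0 r) (poly y1 r) (poly y2 r) i
      else if i = 3 then poly t r else undefined)" for i r
    by (auto simp: c_def from_conj_def)
  have aff: "(\<lambda>i. poly (c i) r) \<in> affine_space 4" for r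
    by (auto simp: affine_space_def ev PiE_def extensional_def)
  let ?B = "{r. poly (pcompose g t) r = 0}"
  have "pcompose g t \<noteq> 0" using g t pcompose_eq_0 by blast
  then have fin: "finite ?B" by (rule poly_roots_finite)
  have "(\<lambda>i. poly (c i) r) \<in> Z" if "r \<notin> ?B" for r
  proof (rule Z[OF aff])
    have "knorm b (\<lambda>i. poly (c i) r) = knorm b (from_conj (poly y0 r) (poly y1 r) (poly y2 r))"
      by (simp add: knorm_def ev)
    also have "\<dots> = poly (y0 * y1 * y2) r"
      by (simp add: norm_eq conj_value_from_conj)
    finally show "knorm b (\<lambda>i. poly (c i) r) = poly f (poly (c 3) r)"
      by (simp add: curve poly_pcompose ev)
    show "poly g (poly (c 3) r) \<noteq> 0"
      using that by (simp add: ev poly_pcompose)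
  qed
  then have "(\<lambda>i. poly (c i) 0) \<in> Z"
    by (rule zariski_closed_curve[OF assms(1) fin aff])
  moreover have "(\<lambda>i. poly (c i) 0) = x"
  proof
    fix i
    show "poly (c i) 0 = x i"
      using x from_conj_conj_value[of i x]
      by (auto simp: ev at affine_space_def PiE_def extensional_def)
  qed
  ultimately show ?thesis by simp
qed

text \<open>Near a zero \<open>x 3\<close> of \<open>f\<close>, moving $t$ by \<open>s = r (y\<^sub>1 + r) (y\<^sub>2 + r)\<close> keeps the quotient of
  \<open>f(t)\<close> by \<open>(y\<^sub>1 + r) (y\<^sub>2 + r)\<close> polynomial in \<open>r\<close>, even when \<open>y\<^sub>1\<close> or \<open>y\<^sub>2\<close> vanishes.\<close>

lemma norm_dense_singular:
  assumes "zariski_closed 4 Z" and "g \<noteq> 0"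
    and "\<And>x. x \<in> affine_space 4 \<Longrightarrow> knorm b x = poly f (x 3) \<Longrightarrow>
              poly g (x 3) \<noteq> 0 \<Longrightarrow> x \<in> Z"
    and "x \<in> affine_space 4" and "poly f (x 3) = 0" and "Y0 x = 0"
  shows "x \<in> Z"
proof -
  obtain h where f: "f = [:- x 3, 1:] * h"
    using \<open>poly f (x 3) = 0\<close> by (auto simp: poly_eq_0_iff_dvd)
  define s where "s = [:0, 1:] * [:Y1 x, 1:] * [:Y2 x, 1:]"
  define t where "t = [:x 3:] + s"
  have "degree s = 3" by (simp add: s_def degree_mult_eq)
  then have deg: "degree t > 0" unfolding t_def by (subst degree_add_eq_right) auto
  have "pcompose [:- x 3, 1:] t = s"
    by (simp add: pcompose_pCons t_def)
  then have "pcompose f t = s * pcompose h t"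
    by (simp add: f pcompose_mult del: mult_pCons_left mult_pCons_right)
  then have "([:0, 1:] * pcompose h t) * [:Y1 x, 1:] * [:Y2 x, 1:] = pcompose f t"
    by (simp add: s_def mult_ac del: mult_pCons_left mult_pCons_right)
  from norm_curve[OF assms(1-4) this deg] show ?thesis
    by rule (simp_all add: assms t_def s_def)
qed

lemma norm_dense:
  assumes Z: "zariski_closed 4 Z" "g \<noteq> 0"
    "\<And>x. x \<in> affine_space 4 \<Longrightarrow> knorm b x = poly f (x 3) \<Longrightarrow>
          poly g (x 3) \<noteq> 0 \<Longrightarrow> x \<in> Z"
    and x: "x \<in> affine_space 4" and eq: "knorm b x = poly f (x 3)"
  shows "x \<in> Z"
proof (cases "poly f (x 3) = 0")
  case True
  \<comment> \<open>Replacing \<alpha> by another root permutes the three conjugates cyclically, so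
    whichever of them vanishes can play the role of \<open>Y0\<close>.\<close>
  interpret c1: cubic_splitting "\<omega> * \<alpha>" \<omega> b
    by unfold_locales (rule root1 \<omega> b)+
  interpret c2: cubic_splitting "\<omega> ^ 2 * \<alpha>" \<omega> b
    by unfold_locales (rule root2 \<omega> b)+
  consider "Y0 x = 0" | "Y1 x = 0" | "Y2 x = 0"
    using eq True by (auto simp: norm_eq)
  then show ?thesis
    using norm_dense_singular[OF Z x True] c1.norm_dense_singular[OF Z x True]
      c2.norm_dense_singular[OF Z x True] by cases blast+
next
  case False
  \<comment> \<open>Here t moves linearly while \<open>Y1\<close> and \<open>Y2\<close> stay
    constant; the first coordinate is then f(t) / k.\<close>
  define k where "k = Y1 x * Y2 x"
  have k: "Y0 x * k = poly f (x 3)" using eq by (simp add: norm_eq k_def mult_ac)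
  with False have "k \<noteq> 0" by auto
  let ?t = "[:x 3, 1:]"
  have "smult (1 / k) (pcompose f ?t) * [:Y1 x:] * [:Y2 x:] = pcompose f ?t"
    using \<open>k \<noteq> 0\<close> by (simp add: k_def mult_ac)
  from norm_curve[OF Z x this] show ?thesis
    by rule (use k \<open>k \<noteq> 0\<close> in \<open>simp_all add: poly_pcompose field_simps\<close>)
qed

text \<open>In conjugate coordinates, \<open>x / z\<close> has norm one and \<open>v\<close> is a cube root of it of norm one.\<close>

lemma norm_torsor:
  assumes cubes: "\<And>z :: 'a. \<exists>y. y ^ 3 = z"
    and eq: "knorm b x = knorm b z"
    and nz: "knorm b z \<noteq> 0"
  obtains v where "knorm b v = 1"
    "\<And>i. i < 3 \<Longrightarrow> kmul b z (kmul b v (kmul b v v)) i = x i"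
proof -
  have Y: "Y0 z \<noteq> 0" "Y1 z \<noteq> 0" "Y2 z \<noteq> 0" "Y0 x \<noteq> 0" "Y1 x \<noteq> 0" "Y2 x \<noteq> 0"
    using eq nz by (auto simp: norm_eq)
  obtain p q where pq: "p ^ 3 = Y0 x / Y0 z" "q ^ 3 = Y1 x / Y1 z" using cubes by metis
  have "p \<noteq> 0" "q \<noteq> 0" using pq Y by auto
  \<comment> \<open>This choice forces norm one. Its cube is the remaining quotient because
    \<open>x\<close> and \<open>z\<close> have equal norms.\<close>
  define r where "r = 1 / (p * q)"
  define v where "v = from_conj p q r"
  have v: "Y0 v = p" "Y1 v = q" "Y2 v = r"
    by (simp_all add: v_def conj_value_from_conj)
  have "r ^ 3 = Y2 x / Y2 z"
    using eq Y by (simp add: r_def power_one_over power_mult_distrib pq norm_eq field_simps)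
  then have cube: "Y0 z * (p * (p * p)) = Y0 x" "Y1 z * (q * (q * q)) = Y1 x" "Y2 z * (r * (r * r)) = Y2 x"
    using pq Y by (simp_all add: power3_eq_cube mult.assoc)
  have "knorm b v = 1"
    using \<open>p \<noteq> 0\<close> \<open>q \<noteq> 0\<close> by (simp add: norm_eq v r_def)
  moreover have "kmul b z (kmul b v (kmul b v v)) i = x i" if "i < 3" for i
    by (rule conj_value_eqI[OF _ _ _ that]) (simp_all only: conj_value_kmul' v cube)
  ultimately show thesis by (rule that)
qed

end

lemma cubic_splitting_exists:
  fixes b :: "'a::{alg_closed_field, field_char_0}"
  assumes "b \<noteq> 0"
  obtains \<alpha> \<omega> where "cubic_splitting \<alpha> \<omega> b"
proof -
  obtain \<alpha> where "\<alpha> ^ 3 = - b" using nth_root_exists[of 3 "- b"] by auto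
  moreover have "\<exists>x. poly [:1, 1, 1::'a:] x = 0" by (rule alg_closed_imp_poly_has_root) simp
  then obtain \<omega> :: 'a where "poly [:1, 1, 1:] \<omega> = 0" by blast
  ultimately have "cubic_splitting \<alpha> \<omega> b"
    using assms by unfold_locales (simp_all add: power2_eq_square algebra_simps)
  then show thesis by (rule that)
qed


section \<open>The rational curve on the threefold\<close>

text \<open>Hypothesis \<open>t\<close> is the remaining linear equation a1 t + a0 = b^2 (c/u)^3 - b
  u^3, cleared of denominators.\<close>

lemma norm_form_on_curve:
  fixes u :: "'a::field"
  assumes "u \<noteq> 0" and c: "3 * b * c = a2"
    and t: "a1 * u ^ 3 * t = b ^ 2 * c ^ 3 - b * u ^ 6 - a0 * u ^ 3"
  shows "norm_form b (t ^ m) u (c / u) = t ^ (3 * m) + a2 * t ^ m + a1 * t + a0"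
proof -
  have "a1 * t + a0 = b ^ 2 * (c / u) ^ 3 - b * u ^ 3"
  proof -
    have "u ^ 3 * (a1 * t + a0) = u ^ 3 * (b ^ 2 * (c / u) ^ 3 - b * u ^ 3)"
      using t \<open>u \<noteq> 0\<close> by (simp add: algebra_simps power_divide flip: power_add)
    then show ?thesis using \<open>u \<noteq> 0\<close> by simp
  qed
  moreover have "3 * b * t ^ m * u * (c / u) = a2 * t ^ m"
    using \<open>u \<noteq> 0\<close> by (simp flip: c)
  moreover have "(t ^ m) ^ 3 = t ^ (3 * m)"
    by (simp add: mult.commute flip: power_mult)
  ultimately show ?thesis
    by (simp add: norm_form_def)
qed

text \<open>The equation is quadratic in w = u^3, so it suffices to take a cube root of a nonzero
  solution w.\<close>

lemma curve_parameter_exists: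
  fixes b :: "'a::{alg_closed_field, field_char_0}"
  assumes "b \<noteq> 0" and "a1 * t + a0 \<noteq> 0"
  obtains u where "u \<noteq> 0" "a1 * u ^ 3 * t = b ^ 2 * c ^ 3 - b * u ^ 6 - a0 * u ^ 3"
proof -
  define e where "e = a1 * t + a0"
  let ?q = "\<lambda>w. b * w ^ 2 + e * w - b ^ 2 * c ^ 3"
  have "\<exists>w. poly [:- (b ^ 2 * c ^ 3), e, b:] w = 0"
    using assms by (intro alg_closed_imp_poly_has_root) simp
  then obtain w where "?q w = 0" by (auto simp: power2_eq_square algebra_simps)
  have "\<exists>w. w \<noteq> 0 \<and> ?q w = 0"
  proof (cases "w = 0")
    case True
    \<comment> \<open>The root 0 makes the constant term vanish, and then the other root is -e/b,
      nonzero because e is.\<close>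
    then have "?q (- e / b) = 0"
      using \<open>?q w = 0\<close> \<open>b \<noteq> 0\<close> by (simp add: field_simps power2_eq_square)
    then show ?thesis using assms by (intro exI[of _ "- e / b"]) (simp add: e_def[symmetric])
  qed (use \<open>?q w = 0\<close> in blast)
  then obtain w where w: "w \<noteq> 0" "?q w = 0" by blast
  obtain u where u: "u ^ 3 = w" using nth_root_exists[of 3 w] by auto
  have "u ^ 6 = w ^ 2" by (simp flip: u power_mult)
  with u w have "u \<noteq> 0" "a1 * u ^ 3 * t = b ^ 2 * c ^ 3 - b * u ^ 6 - a0 * u ^ 3"
    by (auto simp: e_def algebra_simps)
  then show thesis by (rule that)
qed

lemma kmul_divide_left:
  fixes x :: "nat \<Rightarrow> 'a::field"
  shows "kmul b (\<lambda>i. x i / d) y i = kmul b x y i / d"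
  by (simp add: kmul_def divide_inverse algebra_simps)

section \<open>Unirationality\<close>

lemma poly_tetranomial:
  fixes f :: "'k::field poly"
  assumes "f = monom 1 (3 * m) + monom a2 m + monom a1 1 + monom a0 0"
  shows "poly (map_poly to_ac f) t = t ^ (3 * m) + to_ac a2 * t ^ m + to_ac a1 * t + to_ac a0"
proof -
  have "map_poly to_ac (p + q) = map_poly to_ac p + (map_poly to_ac q :: 'k alg_closure poly)" for p q
    by (intro poly_eqI) (simp add: coeff_map_poly)
  then show ?thesis by (simp add: assms map_poly_monom poly_monom)
qed

locale threefold =
  fixes b a0 a1 a2 :: "'k::field_char_0" and m :: nat and f :: "'k poly"
  assumes b: "b \<noteq> 0" and a1: "a1 \<noteq> 0" and m: "m > 0"
    and f: "f = monom 1 (3 * m) + monom a2 m + monom a1 1 + monom a0 0"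
begin

definition c :: 'k where "c = a2 / (3 * b)"

definition t_num :: "'k mpoly" where
  "t_num = Const (b ^ 2 * c ^ 3) - Const b * Var 0 ^ 6 - Const a0 * Var 0 ^ 3"

definition t_den :: "'k mpoly" where
  "t_den = Const a1 * Var 0 ^ 3"

text \<open>Numerators of t^m, u and c/u over the common denominator
  \<open>t_den ^ m * Var 0\<close>.\<close>

definition x_num :: "nat \<Rightarrow> 'k mpoly" where
  "x_num i = (if i = 0 then t_num ^ m * Var 0
     else if i = 1 then Var 0 ^ 2 * t_den ^ m else Const c * t_den ^ m)"

definition v :: "nat \<Rightarrow> 'k mpoly" where
  "v i = (if i < 3 then Var (Suc i) else 0)"

definition v_norm :: "'k mpoly" where
  "v_norm = knorm (Const b) v"

text \<open>The rational point \<open>(t ^ m, u, c / u)\<close> of the fibre over \<open>t\<close>, with \<open>u\<close> the variable of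
  index 0, times \<open>v\<^sup>3 / N(v)\<close>, where \<open>v\<close> is the generic element of $K$.\<close>

definition \<phi> :: "'k rat_tuple" where
  "\<phi> i = (if i < 3
     then (kmul (Const b) x_num (kmul (Const b) v (kmul (Const b) v v)) i, t_den ^ m * Var 0 * v_norm)
     else (t_num, t_den))"

section \<open>Values of the map at geometric points\<close>

definition t_val :: "'k alg_closure \<Rightarrow> 'k alg_closure" where
  "t_val u = (to_ac b ^ 2 * to_ac c ^ 3 - to_ac b * u ^ 6 - to_ac a0 * u ^ 3) / (to_ac a1 * u ^ 3)"

definition x_val :: "'k alg_closure \<Rightarrow> nat \<Rightarrow> 'k alg_closure" where
  "x_val u i = (if i = 0 then t_val u ^ m else if i = 1 then u else to_ac c / u)"

abbreviation "N \<equiv> knorm (to_ac b :: 'k alg_closure)"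

lemmas eval_simps = to_ac.eval_diff to_ac.eval_add to_ac.eval_mult to_ac.eval_power
  to_ac.eval_Const to_ac.eval_Var to_ac.eval_numeral to_ac.eval_0

lemma v_norm_eval:
  "eval_mpoly to_ac p v_norm = N (\<lambda>i. p (Suc i))"
  by (simp add: v_norm_def v_def knorm_def norm_form_def eval_simps)

lemma mem_\<phi>_dom:
  "p \<in> rat_dom 4 4 \<phi> \<longleftrightarrow> p \<in> affine_space 4 \<and> p 0 \<noteq> 0 \<and> N (\<lambda>i. p (Suc i)) \<noteq> 0"
proof -
  have den: "eval_mpoly to_ac p (snd (\<phi> i)) =
      (if i < 3 then (to_ac a1 * p 0 ^ 3) ^ m * p 0 * N (\<lambda>i. p (Suc i)) else to_ac a1 * p 0 ^ 3)" for i
    by (simp add: \<phi>_def v_norm_eval t_den_def eval_simps)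
  have all: "(\<forall>i<4. P i) \<longleftrightarrow> P (0::nat) \<and> P 1 \<and> P 2 \<and> P 3" for P
    by (auto simp: eval_nat_numeral less_Suc_eq)
  have "p \<in> rat_dom 4 4 \<phi> \<longleftrightarrow> p \<in> affine_space 4 \<and> (\<forall>i<4. eval_mpoly to_ac p (snd (\<phi> i)) \<noteq> 0)"
    by (simp add: rat_dom_def)
  then show ?thesis unfolding all den using a1 by auto
qed

lemma \<phi>_apply:
  assumes "p \<in> rat_dom 4 4 \<phi>"
  defines "w \<equiv> \<lambda>i. p (Suc i)"
  shows "i < 3 \<Longrightarrow> rat_apply 4 \<phi> p i =
           kmul (to_ac b) (x_val (p 0)) (kmul (to_ac b) w (kmul (to_ac b) w w)) i / N w"
    and "rat_apply 4 \<phi> p 3 = t_val (p 0)"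
proof -
  have u: "p 0 \<noteq> 0" and "N w \<noteq> 0" using assms(1) by (auto simp: mem_\<phi>_dom w_def)
  show "rat_apply 4 \<phi> p 3 = t_val (p 0)"
    by (simp add: rat_apply_def \<phi>_def t_num_def t_den_def t_val_def eval_simps)
  assume i: "i < 3"
  let ?e = "eval_mpoly to_ac p"
  let ?d = "?e t_den ^ m * p 0"
  have d: "?e t_den \<noteq> 0" using u a1 by (simp add: t_den_def eval_simps)
  have tv: "t_val (p 0) = ?e t_num / ?e t_den"
    by (simp add: t_val_def t_num_def t_den_def eval_simps)
  have "x_val (p 0) i = ?e (x_num i) / ?d" for i
    using u d by (simp add: x_val_def x_num_def tv eval_simps power_divide power2_eq_square)
  then have x: "x_val (p 0) = (\<lambda>i. ?e (x_num i) / ?d)" by blast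
  have vw: "kmul (to_ac b) (\<lambda>j. ?e (v j)) (kmul (to_ac b) (\<lambda>j. ?e (v j)) (\<lambda>j. ?e (v j))) =
      kmul (to_ac b) w (kmul (to_ac b) w w)"
    by (simp add: kmul_def fun_eq_iff v_def w_def eval_simps)
  have "?e (kmul (Const b) x_num (kmul (Const b) v (kmul (Const b) v v)) i) =
      kmul (to_ac b) (\<lambda>j. ?e (x_num j)) (kmul (to_ac b) w (kmul (to_ac b) w w)) i"
    by (simp add: to_ac.eval_kmul vw)
  \<comment> \<open>Linearity of \<open>kmul\<close> in its first argument pulls out the common
    denominator.\<close>
  moreover have "kmul (to_ac b) (x_val (p 0)) y i = kmul (to_ac b) (\<lambda>j. ?e (x_num j)) y i / ?d" for y
    by (simp only: x kmul_divide_left)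
  ultimately show "rat_apply 4 \<phi> p i =
      kmul (to_ac b) (x_val (p 0)) (kmul (to_ac b) w (kmul (to_ac b) w w)) i / N w"
    using i by (simp add: rat_apply_def \<phi>_def v_norm_eval w_def eval_simps)
qed

lemma N_x_val:
  assumes "u \<noteq> 0"
  shows "N (x_val u) = poly (map_poly to_ac f) (t_val u)"
proof -
  have "3 * to_ac b * to_ac c = (to_ac (3 * b * c) :: 'k alg_closure)" by simp
  also have "\<dots> = to_ac a2" using b by (simp add: c_def)
  finally have "norm_form (to_ac b) (t_val u ^ m) u (to_ac c / u) = poly (map_poly to_ac f) (t_val u)"
    unfolding poly_tetranomial[OF f]
    using assms a1 by (intro norm_form_on_curve) (simp_all add: t_val_def)
  then show ?thesis by (simp add: knorm_def x_val_def)
qed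

lemma rational_map_\<phi>: "rational_map 4 4 (zero_locus to_ac 4 {S_equation b f}) \<phi>"
proof -
  have v: "v i \<in> mpoly_ring 4" for i
    using mpoly_ring_Const[of 0 4] by (auto simp: v_def Const_def intro: mpoly_ring_Var)
  have t: "t_num \<in> mpoly_ring 4" "t_den \<in> mpoly_ring 4"
    by (auto simp: t_num_def t_den_def intro!: mpoly_ring_intros)
  have "x_num i \<in> mpoly_ring 4" for i
    using t by (auto simp: x_num_def intro!: mpoly_ring_intros)
  moreover have "v_norm \<in> mpoly_ring 4"
    unfolding v_norm_def knorm_def norm_form_def by (intro mpoly_ring_intros v)
  ultimately have ring: "fst (\<phi> i) \<in> mpoly_ring 4 \<and> snd (\<phi> i) \<in> mpoly_ring 4" for i
    using t v by (auto simp: \<phi>_def intro!: mpoly_ring_kmul mpoly_ring_intros)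
  \<comment> \<open>The point u = 1, v = (1, 0, 0), where v is the unit element of norm one. It lies
    in the domain, so no denominator is the zero polynomial.\<close>
  define q :: "nat \<Rightarrow> 'k alg_closure" where "q = restrict (\<lambda>i. if i < 2 then 1 else 0) {..<4}"
  have "q \<in> rat_dom 4 4 \<phi>"
    by (simp add: q_def mem_\<phi>_dom affine_space_def knorm_def norm_form_def)
  then have "snd (\<phi> i) \<noteq> 0" if "i < 4" for i
    using that to_ac.eval_0[of q] by (force simp: rat_dom_def)
  moreover have "rat_apply 4 \<phi> p \<in> zero_locus to_ac 4 {S_equation b f}"
    if p: "p \<in> rat_dom 4 4 \<phi>" for p
  proof -
    obtain \<alpha> \<omega> where "cubic_splitting \<alpha> \<omega> (to_ac b)"
      using cubic_splitting_exists[of "to_ac b"] b by auto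
    then interpret cubic_splitting \<alpha> \<omega> "to_ac b" .
    let ?w = "\<lambda>i. p (Suc i)"
    let ?y = "kmul (to_ac b) (x_val (p 0)) (kmul (to_ac b) ?w (kmul (to_ac b) ?w ?w))"
    have nz: "p 0 \<noteq> 0" "N ?w \<noteq> 0" using p by (simp_all add: mem_\<phi>_dom)
    have "N (rat_apply 4 \<phi> p) = N (\<lambda>i. ?y i / N ?w)"
      using \<phi>_apply(1)[OF p] by (simp add: knorm_def)
    \<comment> \<open>The norm is homogeneous of degree 3, and the norm of \<open>?y\<close>
      contains the factor \<open>N ?w ^ 3\<close>, which cancels.\<close>
    also have "\<dots> = N ?y / N ?w ^ 3"
      unfolding norm_eq conj_value_divide by (simp add: power3_eq_cube)
    also have "\<dots> = N (x_val (p 0))"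
      using nz by (simp add: norm_kmul power3_eq_cube)
    finally have "N (rat_apply 4 \<phi> p) = poly (map_poly to_ac f) (rat_apply 4 \<phi> p 3)"
      using nz by (simp add: N_x_val \<phi>_apply(2)[OF p])
    then show ?thesis
      by (simp add: zero_locus_def to_ac.eval_S_equation knorm_def affine_space_def rat_apply_def)
  qed
  ultimately show ?thesis using ring by (auto simp: rational_map_def)
qed

text \<open>The condition on a1 t + a0 yields a parameter u whose curve point lies in the fibre of
  \<open>x\<close>. The two points then have the same nonzero norm and differ by the cube of an
  element of norm one.\<close>

lemma \<phi>_surj:
  assumes x: "x \<in> affine_space 4" and eq: "N x = poly (map_poly to_ac f) (x 3)"
    and nz: "poly (map_poly to_ac f) (x 3) \<noteq> 0" "to_ac a1 * x 3 + to_ac a0 \<noteq> 0"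
  shows "x \<in> rat_apply 4 \<phi> ` rat_dom 4 4 \<phi>"
proof -
  obtain \<alpha> \<omega> where "cubic_splitting \<alpha> \<omega> (to_ac b)"
    using cubic_splitting_exists[of "to_ac b"] b by auto
  then interpret cubic_splitting \<alpha> \<omega> "to_ac b" .
  obtain u where u: "u \<noteq> 0"
    "to_ac a1 * u ^ 3 * x 3 = to_ac b ^ 2 * to_ac c ^ 3 - to_ac b * u ^ 6 - to_ac a0 * u ^ 3"
    using curve_parameter_exists[of "to_ac b" "to_ac a1" "x 3" "to_ac a0" "to_ac c"] nz(2) b by auto
  have t: "t_val u = x 3" using u a1 by (simp add: t_val_def flip: u(2))
  have cubes: "\<exists>y. y ^ 3 = z" for z :: "'k alg_closure"
    using nth_root_exists[of 3 z] by auto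
  have "N x = N (x_val u)" "N (x_val u) \<noteq> 0" using eq nz u by (simp_all add: N_x_val t)
  then obtain w where w: "N w = 1"
    "\<And>i. i < 3 \<Longrightarrow> kmul (to_ac b) (x_val u) (kmul (to_ac b) w (kmul (to_ac b) w w)) i = x i"
    using norm_torsor[OF cubes, of x "x_val u"] by metis
  \<comment> \<open>Variable 0 carries u and variables 1 to 3 carry w. Since w has norm one,
    dividing by N(w) changes nothing.\<close>
  define p where "p = restrict (case_nat u w) {..<4}"
  have p0: "p 0 = u" and ps: "i < 3 \<Longrightarrow> p (Suc i) = w i" for i
    by (simp_all add: p_def)
  have "N (\<lambda>i. p (Suc i)) = 1" using w(1) ps[of 0] ps[of 1] ps[of 2] by (simp add: knorm_def)
  moreover have "p \<in> affine_space 4" by (simp add: affine_space_def p_def)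
  ultimately have dom: "p \<in> rat_dom 4 4 \<phi>" using u by (simp add: mem_\<phi>_dom p0)
  have kp: "kmul (to_ac b) (\<lambda>i. p (Suc i)) (kmul (to_ac b) (\<lambda>i. p (Suc i)) (\<lambda>i. p (Suc i))) =
      kmul (to_ac b) w (kmul (to_ac b) w w)"
    using ps[of 0] ps[of 1] ps[of 2] by (simp add: kmul_def fun_eq_iff)
  have "rat_apply 4 \<phi> p = x"
  proof (rule extensionalityI[of _ "{..<4}"])
    show "rat_apply 4 \<phi> p \<in> extensional {..<4}" by (simp add: rat_apply_def)
    show "x \<in> extensional {..<4}" using x by (simp add: affine_space_def PiE_def)
    fix i :: nat assume "i \<in> {..<4}"
    then consider "i < 3" | "i = 3" by fastforce
    then show "rat_apply 4 \<phi> p i = x i"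
    proof cases
      case 1
      then show ?thesis
        using \<phi>_apply(1)[OF dom 1] w(2)[OF 1] \<open>N (\<lambda>i. p (Suc i)) = 1\<close> unfolding kp p0 by simp
    qed (use \<phi>_apply(2)[OF dom] t p0 in simp)
  qed
  with dom show ?thesis by blast
qed

lemma dominant_\<phi>: "dominant 4 4 (zero_locus to_ac 4 {S_equation b f}) \<phi>"
  unfolding dominant_def zariski_dense_def
proof (intro conjI allI impI subsetI)
  fix y assume "y \<in> rat_apply 4 \<phi> ` rat_dom 4 4 \<phi>"
  then show "y \<in> zero_locus to_ac 4 {S_equation b f}"
    using rational_map_\<phi> by (auto simp: rational_map_def)
next
  fix Z x
  assume Z: "zariski_closed 4 Z" "rat_apply 4 \<phi> ` rat_dom 4 4 \<phi> \<subseteq> Z"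
    and x: "x \<in> zero_locus to_ac 4 {S_equation b f}"
  obtain \<alpha> \<omega> where "cubic_splitting \<alpha> \<omega> (to_ac b)"
    using cubic_splitting_exists[of "to_ac b"] b by auto
  then interpret cubic_splitting \<alpha> \<omega> "to_ac b" .
  let ?F = "map_poly to_ac f :: 'k alg_closure poly"
  \<comment> \<open>The zeros of \<open>?g\<close> are the values of t excluded by
    \<open>\<phi>_surj\<close>.\<close>
  let ?g = "?F * [:to_ac a0, to_ac a1:]"
  \<comment> \<open>As m > 0, the exponent 3m differs from m, 1 and 0, so no other term
    contributes.\<close>
  have "coeff ?F (3 * m) = 1" using m by (simp add: coeff_map_poly f)
  then have "?F \<noteq> 0" by auto
  moreover have "[:to_ac a0, to_ac a1:] \<noteq> 0" using a1 by simp
  ultimately have "?g \<noteq> 0" by (simp only: mult_eq_0_iff simp_thms)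
  show "x \<in> Z"
  proof (rule norm_dense[OF Z(1) \<open>?g \<noteq> 0\<close>])
    show "x \<in> affine_space 4" "N x = poly ?F (x 3)"
      using x by (simp_all add: zero_locus_def to_ac.eval_S_equation knorm_def)
    fix z assume "z \<in> affine_space 4" "N z = poly ?F (z 3)" "poly ?g (z 3) \<noteq> 0"
    then have "z \<in> rat_apply 4 \<phi> ` rat_dom 4 4 \<phi>"
      by (intro \<phi>_surj) (simp_all add: mult.commute add.commute del: mult_pCons_right)
    then show "z \<in> Z" using Z(2) by blast
  qed
qed

end

theorem theorem2p8:
  fixes b a0 a1 a2 :: "'k::field_char_0" and m :: nat and f :: "'k poly"
  assumes "b \<notin> range (\<lambda>c. c ^ 3)"
    and "m > 0"
    and "f = monom 1 (3 * m) + monom a2 m + monom a1 1 + monom a0 0"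
    and "a1 \<noteq> 0"
  shows "k_unirational 4 {S_equation b f}"
proof -
  \<comment> \<open>Zero is the cube of zero.\<close>
  have "b \<noteq> 0" using assms(1) by (metis rangeI power_zero_numeral)
  then interpret threefold b a0 a1 a2 m f
    using assms by unfold_locales
  show ?thesis
    unfolding k_unirational_def using rational_map_\<phi> dominant_\<phi> by blast
qed

end
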